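(* Let $c = 1/20$ and let $n$ be an odd positive integer. Define vectors $v_1,\dotsc,v_n \in \mathbb{R}^2$ by $v_n = (1,0)$ and, for $1 \leq i \leq \lfloor n/2 \rfloor$, $v_{2i-1} = v_{2i} = (\cos\theta_i, \sin\theta_i)$ where $\theta_i = \arcsin c^i$. If $\xi_1,\dotsc,\xi_n$ are independent random variables, each uniformly distributed on $\{-1,+1\}$, then \[ \mathbb{P}\bigl(\|\xi_1 v_1 + \dotsb + \xi_n v_n\| \leq 1\bigr) = 2^{-\lfloor n/2 \rfloor}. \]
   Context: $\|\cdot\|$ denotes the Euclidean norm on $\mathbb{R}^2$. *)

theory Defs
  imports "HOL-Probability.Probability"
begin

end

theory Submission
  imports Defs
begin

text \<open>
  Put a i = (\<xi> (2 i - 1) + \<xi> (2 i)) / 2, so that the sum is \<xi> n (1, 0) + 2 (\<Sum>i. a i u i) with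
  u i = (cos (\<theta> i), sin (\<theta> i)). If all a i vanish, the norm is 1. Otherwise let k be the least
  index with a k \<noteq> 0. The second coordinate is dominated by its k-th term, so its square is close to
  4 c^(2k). The first coordinate differs from an odd integer by at most
  2 (\<Sum>i\<ge>k. 1 - cos (\<theta> i)), which is about c^(2k), so its square is at least about 1 - 2 c^(2k).
  Hence the norm exceeds 1. The event therefore says, up to a null set, that the two signs of each
  pair are opposite.
\<close>

section \<open>Geometric tails, pairing of indices, and the defect of the cosine\<close>

lemma sum_power_tail_le:
  fixes t :: real
  assumes "0 \<le> t" "t < 1"
  shows "(\<Sum>i=k..m. t ^ i) \<le> t ^ k / (1 - t)"
proof (cases "k \<le> m")
  case True
  have "(1 - t) * (\<Sum>i=k..m. t ^ i) = t ^ k - t ^ Suc m"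
    using True by (rule sum_gp_multiplied)
  also have "\<dots> \<le> t ^ k" using assms by simp
  finally show ?thesis using assms by (simp add: pos_le_divide_eq mult.commute)
qed (use assms in simp)

text \<open>Fits the repetition of the vectors: indices 2 i - 1 and 2 i carry the same vector, so
  their signs can be added first.\<close>

lemma sum_pair_up:
  fixes f :: "nat \<Rightarrow> 'b::comm_monoid_add"
  shows "(\<Sum>j=1..2 * m + 1. f j) = f (2 * m + 1) + (\<Sum>i=1..m. f (2 * i - 1) + f (2 * i))"
proof -
  have "(\<Sum>j=1..2 * m. f j) = (\<Sum>i=1..m. f (2 * i - 1) + f (2 * i))"
    by (induction m) (simp_all add: add.assoc)
  then show ?thesis by (simp add: add.commute)
qed

text \<open>With C = cos (arcsin s), 1 - C = s^2 / (1 + C), and C >= 1/2 yields the factor 2/3. The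
  constant 1 in its place would be too weak for the final comparison in
  \<open>sum_squares_gt_one\<close>.\<close>

lemma one_minus_cos_arcsin_le:
  fixes s :: real
  assumes "0 \<le> s" "s \<le> 1 / 2"
  shows "0 \<le> 1 - cos (arcsin s)" and "1 - cos (arcsin s) \<le> 2 / 3 * s\<^sup>2"
proof -
  define C where "C = cos (arcsin s)"
  have C: "C = sqrt (1 - s\<^sup>2)" using assms by (simp add: C_def cos_arcsin)
  have s2: "s\<^sup>2 \<le> (1 / 2)\<^sup>2" using assms by (intro power_mono) auto
  have C2: "C\<^sup>2 = 1 - s\<^sup>2" using s2 by (simp add: C power2_eq_square)
  have "1 / 2 \<le> C" unfolding C by (rule real_le_rsqrt) (use s2 in \<open>simp add: power2_eq_square\<close>)
  moreover have "C \<le> 1" by (simp add: C_def)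
  \<comment> \<open>Substituting C^2 = 1 - s^2 turns this product into 3 (C - 1) + 2 s^2, which
    avoids dividing by 1 + C.\<close>
  ultimately have "0 \<le> (1 - C) * (2 * C - 1)" by simp
  then have "1 - C \<le> 2 / 3 * s\<^sup>2"
    using C2 by (simp add: algebra_simps power2_eq_square)
  then show "1 - cos (arcsin s) \<le> 2 / 3 * s\<^sup>2" by (simp add: C_def)
  show "0 \<le> 1 - cos (arcsin s)" by simp
qed

section \<open>Signed sums with a pair that does not cancel\<close>

text \<open>Here \<open>e\<close> is the sign of the unpaired vector and \<open>a i\<close> is half
  the sum of the i-th pair of signs. In units of t^2 with t = c^k, the first square falls below 1 by
  at most 3200/1197 and the second is at least 1296/361; the number 3 separates the two.\<close>

lemma sum_squares_gt_one:
  fixes a :: "nat \<Rightarrow> int" and e :: int and c :: real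
  assumes c: "c = 1 / 20" and e: "odd e" and a: "\<And>i. \<bar>a i\<bar> \<le> 1"
    and k: "1 \<le> k" "k \<le> m" "a k \<noteq> 0" and below: "\<And>i. 1 \<le> i \<Longrightarrow> i < k \<Longrightarrow> a i = 0"
  shows "1 < (of_int e + 2 * (\<Sum>i=1..m. of_int (a i) * cos (arcsin (c ^ i))))\<^sup>2
           + (2 * (\<Sum>i=1..m. of_int (a i) * c ^ i))\<^sup>2"
proof -
  define t where "t = c ^ k"
  have t: "0 < t" "t \<le> 1 / 20"
    using k power_decreasing[of 1 k c] by (simp_all add: t_def c)
  have abs_a: "\<bar>real_of_int (a i)\<bar> \<le> 1" for i
    using a[of i] by linarith
  have split: "(\<Sum>i=1..m. of_int (a i) * g i) = (\<Sum>i=k..m. of_int (a i) * g i)" for g :: "nat \<Rightarrow> real"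
    using k by (intro sum.mono_neutral_right) (auto simp: below)
  \<comment> \<open>\<open>D\<close> collects the errors made by replacing every cosine by 1, and
    \<open>N\<close> is the integer this replacement produces, so the first coordinate is N - 2
    D.\<close>
  define D where "D = (\<Sum>i=1..m. of_int (a i) * (1 - cos (arcsin (c ^ i))))"
  define Y where "Y = (\<Sum>i=1..m. of_int (a i) * c ^ i)"
  define N where "N = e + 2 * (\<Sum>i=1..m. a i)"

  have "\<bar>D\<bar> \<le> (\<Sum>i=k..m. \<bar>of_int (a i) * (1 - cos (arcsin (c ^ i)))\<bar>)"
    unfolding D_def split by (rule sum_abs)
  also have "\<dots> \<le> (\<Sum>i=k..m. 2 / 3 * (c\<^sup>2) ^ i)"
  proof (rule sum_mono)
    fix i assume "i \<in> {k..m}"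
    then have ci: "0 \<le> c ^ i" "c ^ i \<le> 1 / 2"
      using k power_decreasing[of 1 i c] by (auto simp: c)
    have "\<bar>of_int (a i) * (1 - cos (arcsin (c ^ i)))\<bar> \<le> 1 * (1 - cos (arcsin (c ^ i)))"
      unfolding abs_mult using one_minus_cos_arcsin_le(1)[OF ci] abs_a[of i]
      by (intro mult_mono) auto
    also have "\<dots> \<le> 2 / 3 * (c\<^sup>2) ^ i"
      using one_minus_cos_arcsin_le(2)[OF ci] by (simp add: power_mult[symmetric] mult.commute)
    finally show "\<bar>of_int (a i) * (1 - cos (arcsin (c ^ i)))\<bar> \<le> 2 / 3 * (c\<^sup>2) ^ i" .
  qed
  also have "\<dots> \<le> 2 / 3 * ((c\<^sup>2) ^ k / (1 - c\<^sup>2))"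
    unfolding sum_distrib_left[symmetric]
    by (intro mult_left_mono sum_power_tail_le) (simp_all add: c power2_eq_square)
  \<comment> \<open>The ratio is c^2 = 1/400, and 2/3 * 400/399 = 800/1197.\<close>
  also have "\<dots> = 800 / 1197 * t\<^sup>2"
    by (simp add: t_def power_mult[symmetric] mult.commute) (simp add: c power2_eq_square)
  finally have D: "\<bar>D\<bar> \<le> 800 / 1197 * t\<^sup>2" .

  have "(of_int N :: real) - 2 * D = of_int e + 2 * (\<Sum>i=1..m. of_int (a i) * cos (arcsin (c ^ i)))"
    by (simp add: N_def D_def right_diff_distrib sum_subtractf)
  moreover have "1 - 4 * \<bar>D\<bar> \<le> (of_int N - 2 * D)\<^sup>2"
  proof -
    have t2: "t\<^sup>2 \<le> 1 / 400"
      using power_mono[of t "1 / 20" 2] t by (simp add: power2_eq_square)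
    have "odd N" using e by (simp add: N_def)
    then have "1 \<le> \<bar>N\<bar>" by (cases "N = 0") auto
    then have N: "1 \<le> \<bar>real_of_int N\<bar>" by linarith
    \<comment> \<open>Nonnegativity is what permits squaring the next inequality.\<close>
    have "0 \<le> 1 - 2 * \<bar>D\<bar>" using D t2 by linarith
    moreover have "1 - 2 * \<bar>D\<bar> \<le> \<bar>of_int N - 2 * D\<bar>" using N by linarith
    ultimately have "(1 - 2 * \<bar>D\<bar>)\<^sup>2 \<le> (of_int N - 2 * D)\<^sup>2"
      by (metis power2_abs power_mono)
    moreover have "1 - 4 * \<bar>D\<bar> \<le> (1 - 2 * \<bar>D\<bar>)\<^sup>2"
      by (simp add: power2_eq_square algebra_simps)
    ultimately show ?thesis by linarith
  qed
  ultimately have X: "1 - 4 * \<bar>D\<bar>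
      \<le> (of_int e + 2 * (\<Sum>i=1..m. of_int (a i) * cos (arcsin (c ^ i))))\<^sup>2" by simp

  have Y_eq: "Y = of_int (a k) * t + (\<Sum>i=Suc k..m. of_int (a i) * c ^ i)"
    unfolding Y_def split t_def using k by (simp add: sum.atLeast_Suc_atMost)
  have "\<bar>\<Sum>i=Suc k..m. of_int (a i) * c ^ i\<bar> \<le> (\<Sum>i=Suc k..m. \<bar>of_int (a i) * c ^ i\<bar>)"
    by (rule sum_abs)
  also have "\<dots> \<le> (\<Sum>i=Suc k..m. c ^ i)"
  proof (rule sum_mono)
    fix i
    have "\<bar>real_of_int (a i)\<bar> * \<bar>c ^ i\<bar> \<le> 1 * \<bar>c ^ i\<bar>"
      by (intro mult_right_mono abs_a) simp
    then show "\<bar>of_int (a i) * c ^ i\<bar> \<le> c ^ i" by (simp add: abs_mult c)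
  qed
  also have "\<dots> \<le> c ^ Suc k / (1 - c)"
    by (rule sum_power_tail_le) (simp_all add: c)
  \<comment> \<open>c / (1 - c) = 1/19 for c = 1/20.\<close>
  also have "\<dots> = t / 19" by (simp add: t_def c)
  finally have tail: "\<bar>\<Sum>i=Suc k..m. of_int (a i) * c ^ i\<bar> \<le> t / 19" .
  have "a k = 1 \<or> a k = - 1" using a[of k] k by linarith
  \<comment> \<open>The leading term has absolute value t and the tail removes at most t /
    19.\<close>
  then have "18 / 19 * t \<le> \<bar>Y\<bar>" using tail t unfolding Y_eq by auto
  then have "(18 / 19 * t)\<^sup>2 \<le> Y\<^sup>2"
    using t by (metis power2_abs power_mono mult_nonneg_nonneg less_imp_le zero_le_divide_iff zero_le_numeral)
  then have "324 / 361 * t\<^sup>2 \<le> Y\<^sup>2" by (simp add: power2_eq_square)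
  moreover have "0 < t\<^sup>2" using t by simp
  moreover have "(2 * Y)\<^sup>2 = 4 * Y\<^sup>2" by (simp add: power2_eq_square)
  ultimately have "4 * \<bar>D\<bar> < (2 * Y)\<^sup>2" using D by linarith
  then show ?thesis using X unfolding Y_def by linarith
qed

lemma norm_vec2_le_one_iff:
  fixes w :: "real ^ 2"
  shows "norm w \<le> 1 \<longleftrightarrow> (w $ 1)\<^sup>2 + (w $ 2)\<^sup>2 \<le> 1"
  by (simp add: norm_le_square inner_vec_def UNIV_2 power2_eq_square sum_2)

text \<open>If every pair cancels, only plus or minus \<open>v n\<close> remains, of norm exactly 1.
  Otherwise the least index of a pair that does not cancel serves as \<open>k\<close> in
  \<open>sum_squares_gt_one\<close>.\<close>

lemma norm_signed_sum_le_one_iff: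
  fixes v :: "nat \<Rightarrow> real ^ 2" and x :: "nat \<Rightarrow> real"
  assumes c: "c = 1 / 20" and n: "n = 2 * m + 1"
    and vn: "v n = vector [1, 0]"
    and v: "\<And>i. 1 \<le> i \<Longrightarrow> i \<le> m \<Longrightarrow> v (2 * i - 1) = vector [cos (arcsin (c ^ i)), c ^ i]"
      "\<And>i. 1 \<le> i \<Longrightarrow> i \<le> m \<Longrightarrow> v (2 * i) = vector [cos (arcsin (c ^ i)), c ^ i]"
    and x: "\<And>j. j \<in> {1..n} \<Longrightarrow> x j = 1 \<or> x j = - 1"
  shows "norm (\<Sum>j=1..n. x j *\<^sub>R v j) \<le> 1 \<longleftrightarrow> (\<forall>i\<in>{1..m}. x (2 * i) = - x (2 * i - 1))"
proof -
  \<comment> \<open>The half-sums are taken as integers for the parity argument. The case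
    distinction keeps |a i| <= 1 at every index, even outside \<open>{1..m}\<close>, where
    \<open>x\<close> need not take the values 1 and -1.\<close>
  define a :: "nat \<Rightarrow> int" where
    "a i = (if x (2 * i - 1) = x (2 * i) then if x (2 * i) = 1 then 1 else - 1 else 0)" for i
  define e :: int where "e = (if x n = 1 then 1 else - 1)"
  have xe: "x n = of_int e" using x[of n] n by (auto simp: e_def)
  have xa: "x (2 * i - 1) + x (2 * i) = 2 * of_int (a i)" if "i \<in> {1..m}" for i
  proof -
    have "2 * i - 1 \<in> {1..n}" "2 * i \<in> {1..n}" using that n by auto
    then show ?thesis using x[of "2 * i - 1"] x[of "2 * i"] by (auto simp: a_def)
  qed
  have opp: "x (2 * i) = - x (2 * i - 1) \<longleftrightarrow> a i = 0" if "i \<in> {1..m}" for i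
    using xa[OF that] by (auto simp: eq_neg_iff_add_eq_0 add.commute)
  have sum: "(\<Sum>j=1..n. x j * v j $ r)
      = of_int e * v n $ r + (\<Sum>i=1..m. 2 * of_int (a i) * v (2 * i) $ r)" for r
    unfolding n sum_pair_up
  proof (intro arg_cong2[of _ _ _ _ "(+)"] sum.cong refl)
    fix i assume i: "i \<in> {1..m}"
    then have "v (2 * i - 1) = v (2 * i)" using v by simp
    then show "x (2 * i - 1) * v (2 * i - 1) $ r + x (2 * i) * v (2 * i) $ r
        = 2 * of_int (a i) * v (2 * i) $ r"
      using xa[OF i] by (simp only: distrib_right[symmetric])
  qed (use xe n in simp)
  have norm: "norm (\<Sum>j=1..n. x j *\<^sub>R v j) \<le> 1 \<longleftrightarrow>
      (of_int e + 2 * (\<Sum>i=1..m. of_int (a i) * cos (arcsin (c ^ i))))\<^sup>2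
       + (2 * (\<Sum>i=1..m. of_int (a i) * c ^ i))\<^sup>2 \<le> 1"
    by (simp add: norm_vec2_le_one_iff sum[unfolded One_nat_def] vn v sum_distrib_left mult.assoc)
  show ?thesis
  proof (cases "\<forall>i\<in>{1..m}. a i = 0")
    case True
    have "(real_of_int e)\<^sup>2 = 1" by (simp add: e_def)
    then have "norm (\<Sum>j=1..n. x j *\<^sub>R v j) \<le> 1" using True by (simp add: norm[unfolded One_nat_def])
    then show ?thesis using True opp by blast
  next
    case False
    then have "\<exists>i. i \<in> {1..m} \<and> a i \<noteq> 0" by blast
    then obtain k where k: "k \<in> {1..m} \<and> a k \<noteq> 0"
      and least: "\<forall>i<k. \<not> (i \<in> {1..m} \<and> a i \<noteq> 0)"
      by (subst (asm) exists_least_iff) blast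
    have below: "a i = 0" if "1 \<le> i" "i < k" for i
      using least k that by (meson atLeastAtMost_iff le_trans less_imp_le)
    have "odd e" by (simp add: e_def)
    moreover have "\<bar>a i\<bar> \<le> 1" for i by (simp add: a_def)
    ultimately have "\<not> norm (\<Sum>j=1..n. x j *\<^sub>R v j) \<le> 1"
      unfolding norm not_le using k by (intro sum_squares_gt_one[OF c _ _ _ _ _ below]) simp_all
    then show ?thesis using k opp by blast
  qed
qed

section \<open>Probabilities of sign patterns\<close>

context prob_space
begin

text \<open>The two events are disjoint and their probabilities add up to 1. Since \<open>X\<close>
  may take other values on a null set, the conclusion is an almost-everywhere statement.\<close>

lemma AE_sign:
  fixes X :: "'a \<Rightarrow> real"
  assumes X: "X \<in> borel_measurable M"
    and "prob {\<omega> \<in> space M. X \<omega> = 1} = 1 / 2" "prob {\<omega> \<in> space M. X \<omega> = - 1} = 1 / 2"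
  shows "AE \<omega> in M. X \<omega> = 1 \<or> X \<omega> = - 1"
proof -
  have "prob ({\<omega> \<in> space M. X \<omega> = 1} \<union> {\<omega> \<in> space M. X \<omega> = - 1}) = 1"
    using X assms(2,3) by (subst finite_measure_Union) auto
  then have "AE \<omega> in M. \<omega> \<in> {\<omega> \<in> space M. X \<omega> = 1} \<union> {\<omega> \<in> space M. X \<omega> = - 1}"
    using X by (intro AE_prob_1) auto
  then show ?thesis by eventually_elim auto
qed

text \<open>Independence makes the probability of the intersection a product of
  \<open>card I\<close> factors 1/2.\<close>

lemma prob_sign_pattern:
  fixes X :: "nat \<Rightarrow> 'a \<Rightarrow> real"
  assumes indep: "indep_vars (\<lambda>_. borel) X I" and I: "finite I" "I \<noteq> {}"
    and half: "\<And>j. j \<in> I \<Longrightarrow> prob {\<omega> \<in> space M. X j \<omega> = 1} = 1 / 2"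
      "\<And>j. j \<in> I \<Longrightarrow> prob {\<omega> \<in> space M. X j \<omega> = - 1} = 1 / 2"
    and s: "\<And>j. j \<in> I \<Longrightarrow> s j = 1 \<or> s j = - 1"
  shows "prob {\<omega> \<in> space M. \<forall>j\<in>I. X j \<omega> = s j} = 1 / 2 ^ card I"
proof -
  have "{\<omega> \<in> space M. \<forall>j\<in>I. X j \<omega> = s j} = (\<Inter>j\<in>I. X j -` {s j} \<inter> space M)"
    using I by auto
  also have "prob \<dots> = (\<Prod>j\<in>I. prob (X j -` {s j} \<inter> space M))"
    using I by (intro indep_varsD[OF indep]) auto
  also have "\<dots> = (\<Prod>j\<in>I. 1 / 2)"
  proof (rule prod.cong[OF refl])
    fix j assume j: "j \<in> I"
    have "X j -` {s j} \<inter> space M = {\<omega> \<in> space M. X j \<omega> = s j}" by auto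
    then show "prob (X j -` {s j} \<inter> space M) = 1 / 2"
      using half[OF j] s[OF j] by auto
  qed
  finally show ?thesis by (simp add: power_one_over)
qed

text \<open>The event is a disjoint union of full sign patterns, determined by m + 1 free signs: one
  for each pair and one for the last index. This gives 2^(m+1) patterns of probability 2^-(2m+1)
  each.\<close>

lemma prob_opposite_pairs:
  fixes X :: "nat \<Rightarrow> 'a \<Rightarrow> real"
  assumes n: "n = 2 * m + 1"
    and indep: "indep_vars (\<lambda>_. borel) X {1..n}"
    and half: "\<And>j. j \<in> {1..n} \<Longrightarrow> prob {\<omega> \<in> space M. X j \<omega> = 1} = 1 / 2"
      "\<And>j. j \<in> {1..n} \<Longrightarrow> prob {\<omega> \<in> space M. X j \<omega> = - 1} = 1 / 2"
  shows "prob {\<omega> \<in> space M. (\<forall>j\<in>{1..n}. X j \<omega> = 1 \<or> X j \<omega> = - 1) \<and>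
           (\<forall>i\<in>{1..m}. X (2 * i) \<omega> = - X (2 * i - 1) \<omega>)} = 1 / 2 ^ m"
proof -
  \<comment> \<open>\<open>b i\<close> is the sign at index 2 i - 1, so \<open>b (m + 1)\<close>
    belongs to the unpaired index n; \<open>s b\<close> puts the opposite sign at 2 i.
    Extensionality of the functions in \<open>B\<close> makes \<open>B\<close> finite and lets
    values on \<open>{1..m + 1}\<close> determine \<open>b\<close>.\<close>
  define B :: "(nat \<Rightarrow> real) set" where "B = {1..m + 1} \<rightarrow>\<^sub>E {1, - 1}"
  define s :: "(nat \<Rightarrow> real) \<Rightarrow> nat \<Rightarrow> real" where
    "s b j = (if odd j then b ((j + 1) div 2) else - b (j div 2))" for b j
  define A where "A b = {\<omega> \<in> space M. \<forall>j\<in>{1..n}. X j \<omega> = s b j}" for b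
  have fin: "finite B" by (simp add: B_def finite_PiE)
  have card: "card B = 2 ^ (m + 1)" by (simp add: B_def card_PiE numeral_2_eq_2)
  have meas [measurable]: "X j \<in> borel_measurable M" if "j \<in> {1..n}" for j
    using indep that by (auto simp: indep_vars_def)
  have s_odd: "s b (2 * i - 1) = b i" if "1 \<le> i" for b i
    using that by (simp add: s_def)
  have s_even: "s b (2 * i) = - b i" for b i
    by (simp add: s_def)
  have s_sign: "s b j = 1 \<or> s b j = - 1" if "b \<in> B" "j \<in> {1..n}" for b j
  proof -
    have "(j + 1) div 2 \<in> {1..m + 1}" "even j \<Longrightarrow> j div 2 \<in> {1..m + 1}"
      using that(2) n by (auto elim!: evenE)
    moreover have b: "b i = 1 \<or> b i = - 1" if "i \<in> {1..m + 1}" for i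
      using PiE_mem[OF \<open>b \<in> B\<close>[unfolded B_def] that] by simp
    ultimately show ?thesis
      using b[of "(j + 1) div 2"] b[of "j div 2"]
      by (simp only: s_def split: if_split) (metis minus_minus)
  qed
  have "{\<omega> \<in> space M. (\<forall>j\<in>{1..n}. X j \<omega> = 1 \<or> X j \<omega> = - 1) \<and>
           (\<forall>i\<in>{1..m}. X (2 * i) \<omega> = - X (2 * i - 1) \<omega>)} = (\<Union>b\<in>B. A b)" (is "?L = _")
  proof (intro subset_antisym subsetI)
    fix \<omega> assume \<omega>: "\<omega> \<in> ?L"
    \<comment> \<open>The free signs are read off at the odd indices.\<close>
    define b where "b = (\<lambda>i\<in>{1..m + 1}. X (2 * i - 1) \<omega>)"
    have "X (2 * i - 1) \<omega> \<in> {1, - 1}" if "i \<in> {1..m + 1}" for i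
    proof -
      have "2 * i - 1 \<in> {1..n}" using that n by auto
      then show ?thesis using \<omega> by blast
    qed
    then have "b \<in> B" unfolding B_def b_def by (rule restrict_PiE_iff[THEN iffD2, rule_format])
    moreover have "X j \<omega> = s b j" if "j \<in> {1..n}" for j
    proof (cases "odd j")
      case True
      then obtain i where "j = 2 * i + 1" by (elim oddE)
      then show ?thesis using that n by (simp add: s_def b_def)
    next
      case False
      then obtain i where "j = 2 * i" by auto
      then show ?thesis using that n \<omega> by (simp add: s_def b_def)
    qed
    ultimately show "\<omega> \<in> (\<Union>b\<in>B. A b)" using \<omega> by (auto simp: A_def)
  next
    fix \<omega> assume "\<omega> \<in> (\<Union>b\<in>B. A b)"
    then obtain b where b: "b \<in> B" "\<omega> \<in> space M" "\<And>j. j \<in> {1..n} \<Longrightarrow> X j \<omega> = s b j"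
      by (auto simp: A_def)
    have "X (2 * i) \<omega> = - X (2 * i - 1) \<omega>" if "i \<in> {1..m}" for i
    proof -
      have "2 * i - 1 \<in> {1..n}" "2 * i \<in> {1..n}" "1 \<le> i" using that n by auto
      then show ?thesis by (simp only: b(3) s_odd s_even)
    qed
    then show "\<omega> \<in> ?L" using b s_sign by auto
  qed
  also have "prob (\<Union>b\<in>B. A b) = (\<Sum>b\<in>B. prob (A b))"
  proof (rule finite_measure_finite_Union[OF fin])
    show "A ` B \<subseteq> events"
    proof (rule image_subsetI)
      fix b
      show "A b \<in> events" unfolding A_def by (intro sets.sets_Collect_finite_All) measurable
    qed
    \<comment> \<open>The odd positions of a pattern recover \<open>b\<close>, so distinct choices
      give incompatible patterns.\<close>
    show "disjoint_family_on A B"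
    unfolding disjoint_family_on_def
    proof (intro ballI impI equals0I)
      fix b b' \<omega> assume bb: "b \<in> B" "b' \<in> B" "b \<noteq> b'" and \<omega>: "\<omega> \<in> A b \<inter> A b'"
      have "b i = b' i" if "i \<in> {1..m + 1}" for i
      proof -
        have "2 * i - 1 \<in> {1..n}" using that n by auto
        then have "s b (2 * i - 1) = s b' (2 * i - 1)" using \<omega> by (auto simp: A_def)
        then show ?thesis using that by (simp only: s_odd atLeastAtMost_iff)
      qed
      then have "b = b'" using bb unfolding B_def by (intro PiE_ext)
      then show False using bb by simp
    qed
  qed
  also have "\<dots> = (\<Sum>b\<in>B. 1 / 2 ^ n)"
  proof (rule sum.cong[OF refl])
    fix b assume "b \<in> B"
    then show "prob (A b) = 1 / 2 ^ n"
      unfolding A_def using prob_sign_pattern[OF indep _ _ half s_sign] n by simp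
  qed
  also have "\<dots> = 1 / 2 ^ m"
  proof -
    have "n = (m + 1) + m" using n by simp
    then have "(2::real) ^ n = 2 ^ (m + 1) * 2 ^ m" by (simp only: power_add)
    then show ?thesis by (simp add: card)
  qed
  finally show ?thesis .
qed

end

theorem theorem1p3:
  fixes c :: real and n :: nat and \<theta> :: "nat \<Rightarrow> real" and v :: "nat \<Rightarrow> real ^ 2"
    and M :: "'a measure" and \<xi> :: "nat \<Rightarrow> 'a \<Rightarrow> real"
  assumes "c = 1 / 20"
    and "odd n"
    and "\<And>i. 1 \<le> i \<Longrightarrow> i \<le> n div 2 \<Longrightarrow> \<theta> i = arcsin (c ^ i)"
    and "v n = vector [1, 0]"
    and "\<And>i. 1 \<le> i \<Longrightarrow> i \<le> n div 2 \<Longrightarrow> v (2 * i - 1) = vector [cos (\<theta> i), sin (\<theta> i)]"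
    and "\<And>i. 1 \<le> i \<Longrightarrow> i \<le> n div 2 \<Longrightarrow> v (2 * i) = vector [cos (\<theta> i), sin (\<theta> i)]"
    and "prob_space M"
    and "prob_space.indep_vars M (\<lambda>_. borel) \<xi> {1..n}"
    and "\<And>j. j \<in> {1..n} \<Longrightarrow> measure M {\<omega> \<in> space M. \<xi> j \<omega> = 1} = 1 / 2"
    and "\<And>j. j \<in> {1..n} \<Longrightarrow> measure M {\<omega> \<in> space M. \<xi> j \<omega> = -1} = 1 / 2"
  shows "measure M {\<omega> \<in> space M. norm (\<Sum>j=1..n. \<xi> j \<omega> *\<^sub>R v j) \<le> 1} = 1 / 2 ^ (n div 2)"
proof -
  interpret prob_space M by fact
  define m where "m = n div 2"
  have n: "n = 2 * m + 1" using \<open>odd n\<close> by (simp add: m_def)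
  have meas [measurable]: "\<xi> j \<in> borel_measurable M" if "j \<in> {1..n}" for j
    using assms(8) that by (auto simp: indep_vars_def)
  have sin_\<theta>: "sin (arcsin (c ^ i)) = c ^ i" for i
  proof (rule sin_arcsin)
    show "c ^ i \<le> 1" by (rule power_le_one) (simp_all add: assms(1))
    have "0 \<le> c ^ i" by (simp add: assms(1))
    then show "- 1 \<le> c ^ i" by linarith
  qed
  have v: "v (2 * i - 1) = vector [cos (arcsin (c ^ i)), c ^ i]"
    "v (2 * i) = vector [cos (arcsin (c ^ i)), c ^ i]" if "1 \<le> i" "i \<le> m" for i
    using assms(3,5,6)[of i] that by (simp_all add: m_def sin_\<theta>)
  have "AE \<omega> in M. \<forall>j\<in>{1..n}. \<xi> j \<omega> = 1 \<or> \<xi> j \<omega> = - 1"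
    using meas assms(9,10) by (intro AE_finite_allI AE_sign) auto
  \<comment> \<open>The deterministic equivalence applies only where all \<open>\<xi> j\<close> are
    signs, so the events are compared up to a null set. The sign condition is built into the second
    event to make it a union of sign patterns.\<close>
  then have "AE \<omega> in M. \<omega> \<in> {\<omega> \<in> space M. norm (\<Sum>j=1..n. \<xi> j \<omega> *\<^sub>R v j) \<le> 1} \<longleftrightarrow>
      \<omega> \<in> {\<omega> \<in> space M. (\<forall>j\<in>{1..n}. \<xi> j \<omega> = 1 \<or> \<xi> j \<omega> = - 1) \<and>
           (\<forall>i\<in>{1..m}. \<xi> (2 * i) \<omega> = - \<xi> (2 * i - 1) \<omega>)}"
  proof eventually_elim
    case (elim \<omega>)
    then show ?case
      using norm_signed_sum_le_one_iff[OF assms(1) n assms(4) v, of "\<lambda>j. \<xi> j \<omega>"] by auto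
  qed
  then have "prob {\<omega> \<in> space M. norm (\<Sum>j=1..n. \<xi> j \<omega> *\<^sub>R v j) \<le> 1}
      = prob {\<omega> \<in> space M. (\<forall>j\<in>{1..n}. \<xi> j \<omega> = 1 \<or> \<xi> j \<omega> = - 1) \<and>
           (\<forall>i\<in>{1..m}. \<xi> (2 * i) \<omega> = - \<xi> (2 * i - 1) \<omega>)}"
  proof (rule finite_measure_eq_AE)
    show "{\<omega> \<in> space M. norm (\<Sum>j=1..n. \<xi> j \<omega> *\<^sub>R v j) \<le> 1} \<in> events"
      by measurable
    have pair [measurable]: "\<xi> (2 * i) \<in> borel_measurable M" "\<xi> (2 * i - 1) \<in> borel_measurable M"
      if "i \<in> {1..m}" for i
      using that n by (auto intro!: meas)
    show "{\<omega> \<in> space M. (\<forall>j\<in>{1..n}. \<xi> j \<omega> = 1 \<or> \<xi> j \<omega> = - 1) \<and>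
           (\<forall>i\<in>{1..m}. \<xi> (2 * i) \<omega> = - \<xi> (2 * i - 1) \<omega>)} \<in> events"
      by (intro sets.sets_Collect_conj sets.sets_Collect_finite_All) measurable
  qed
  also have "\<dots> = 1 / 2 ^ m"
    by (rule prob_opposite_pairs[OF n assms(8-10)])
  finally show ?thesis by (simp add: m_def)
qed

end
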